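(* Let $f:\mathbb{R}^d\to\mathbb{R}$ be a differentiable function with unique minimizer $x^\star$ which is convex and $L$-smooth for some $L>0$. Let $\varepsilon>0$ and $x_0\in\mathbb{R}^d$, and set $$K=\left\lceil2\left(\log\frac{3}{1+\sqrt3}\right)^{-1}\cdot\log\left(\sqrt{\frac{L}{\varepsilon}}\,\|x_0-x^\star\|\right)\right\rceil,\qquad N_0=4,\qquad N_k=\left\lceil\sqrt{\frac{3}{1+\sqrt3}}\,N_{k-1}+\frac12\right\rceil\quad(k\in\{1,\dots,K\}),$$ where $K$ is a positive integer (as the algorithm requires). Then the output $x_K$ of the algorithm dHFA-eg run from $x_0$ for $K$ iterations with parameter $\lambda=\frac{\sqrt3+1}{2}$, step size $\eta=\frac{1}{\sqrt L}$ and discretization steps $N_1,\dots,N_K$ satisfies $f(x_K)-f(x^\star)\le\varepsilon$, and the total number of gradient evaluations satisfies $$N_{\mathrm{tot}}\le1620\sqrt{\frac{L}{\varepsilon}}\,\|x_0-x^\star\|.$$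
   Context: $f$ is $L$-smooth if $f(x')\le f(x)+\langle\nabla f(x),x'-x\rangle+\frac{L}{2}\|x'-x\|^2$ for all $x,x'\in\mathbb{R}^d$. $\log$ is the natural logarithm. The extragradient integrator with step size $\eta>0$ started at $(x_0,y_0)\in\mathbb{R}^{2d}$ generates, for $n\ge0$, $x_{n+1/2}=x_n+\eta y_n$, $x_{n+1}=x_{n+1/2}-\eta^2\nabla f(x_{n+1/2})$, $y_{n+1}=y_n-\eta\nabla f(x_{n+1})$. Each step counts as 2 gradient evaluations, so the total number of gradient evaluations of the algorithm below is $N_{\mathrm{tot}}=2\sum_{k=1}^KN_k$. Algorithm dHFA-eg. Input: $x_0\in\mathbb{R}^d$, number of iterations $K\in\mathbb{N}$, parameter $\lambda\ge0$, step size $\eta>0$, discretization steps $N_1,\dots,N_K\in\mathbb{N}$ (positive integers). For $k=1,\dots,K$: generate $(x^{(k)}_n,y^{(k)}_n)_{n=1}^{N_k}$ with the extragradient integrator with step size $\eta$ started at $(x^{(k)}_0,y^{(k)}_0)=(x_{k-1},\mathbf{0})$; compute $x^{\mathrm{avg}}(x_{k-1};N_k)=\frac{2}{N_k(N_k+1)}\sum_{n=1}^{N_k}(N_k-n+1)x^{(k)}_n$; set $x_k=\frac{1}{\lambda+1}x^{\mathrm{avg}}(x_{k-1};N_k)+\frac{\lambda}{\lambda+1}x^{(k)}_{N_k}$. Output: $x_K$. *)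

theory Defs
  imports "HOL-Analysis.Analysis"
begin

definition gradient :: "('a::real_inner \<Rightarrow> real) \<Rightarrow> 'a \<Rightarrow> 'a" where
  "gradient f x = (THE g. GDERIV f x :> g)"

lemma gradient_eqI:
  assumes "GDERIV f x :> g"
  shows "gradient f x = g"
  unfolding gradient_def
proof (rule the_equality)
  fix h assume "GDERIV f x :> h"
  then have "(\<lambda>v. v \<bullet> h) = (\<lambda>v. v \<bullet> g)"
    using assms unfolding gderiv_def by (rule has_derivative_unique)
  then have "(h - g) \<bullet> h = (h - g) \<bullet> g"
    by (rule fun_cong)
  then have "(h - g) \<bullet> (h - g) = 0"
    by (simp add: inner_diff_right)
  then show "h = g"
    by simp
qed fact

lemma GDERIV_gradient:
  fixes f :: "'a::euclidean_space \<Rightarrow> real"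
  assumes "f differentiable (at x)"
  shows "GDERIV f x :> gradient f x"
proof -
  obtain D where D: "(f has_derivative D) (at x)"
    using assms unfolding differentiable_def by blast
  then have "linear D"
    by (rule has_derivative_linear)
  then have "D v = v \<bullet> adjoint D 1" for v
    using adjoint_works[of D v 1] by simp
  then have "D = (\<lambda>v. v \<bullet> adjoint D 1)"
    by (rule ext)
  with D have *: "GDERIV f x :> adjoint D 1"
    unfolding gderiv_def by (rule back_subst)
  show ?thesis
    unfolding gradient_eqI[OF *] by (rule *)
qed

text \<open>Only the upper bound of the descent lemma is required, as opposed to Lipschitz continuity
  of the gradient.\<close>

definition L_smooth :: "real \<Rightarrow> ('a::real_inner \<Rightarrow> real) \<Rightarrow> bool" where
  "L_smooth L f \<longleftrightarrow>
    (\<forall>x x'. f x' \<le> f x + gradient f x \<bullet> (x' - x) + L / 2 * (norm (x' - x))\<^sup>2)"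

definition unique_minimizer :: "('a \<Rightarrow> real) \<Rightarrow> 'a \<Rightarrow> bool" where
  "unique_minimizer f x \<longleftrightarrow> {z. \<forall>y. f z \<le> f y} = {x}"

definition eg_step :: "('a::real_inner \<Rightarrow> real) \<Rightarrow> real \<Rightarrow> 'a \<times> 'a \<Rightarrow> 'a \<times> 'a" where
  "eg_step f \<eta> = (\<lambda>(x, y).
    let x_half = x + \<eta> *\<^sub>R y;
        x_next = x_half - \<eta>\<^sup>2 *\<^sub>R gradient f x_half;
        y_next = y - \<eta> *\<^sub>R gradient f x_next
    in (x_next, y_next))"

definition eg_iterate ::
    "('a::real_inner \<Rightarrow> real) \<Rightarrow> real \<Rightarrow> 'a \<times> 'a \<Rightarrow> nat \<Rightarrow> 'a \<times> 'a" where
  "eg_iterate f \<eta> z n = (eg_step f \<eta> ^^ n) z"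

definition x_avg :: "('a::real_inner \<Rightarrow> real) \<Rightarrow> real \<Rightarrow> 'a \<Rightarrow> nat \<Rightarrow> 'a" where
  "x_avg f \<eta> x m =
    (2 / (real m * (real m + 1))) *\<^sub>R
      (\<Sum>n = 1..m. (real m - real n + 1) *\<^sub>R fst (eg_iterate f \<eta> (x, 0) n))"

text \<open>\<open>dHFA_eg f lam \<eta> N x0 k\<close> is the \<open>k\<close>-th outer iterate; of the sequence \<open>N\<close> only the entries
  \<open>N 1, \<dots>, N k\<close> are used.\<close>

primrec dHFA_eg ::
    "('a::real_inner \<Rightarrow> real) \<Rightarrow> real \<Rightarrow> real \<Rightarrow> (nat \<Rightarrow> nat) \<Rightarrow> 'a \<Rightarrow> nat \<Rightarrow> 'a" where
  "dHFA_eg f lam \<eta> N x0 0 = x0"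
| "dHFA_eg f lam \<eta> N x0 (Suc k) =
    (let x = dHFA_eg f lam \<eta> N x0 k; m = N (Suc k) in
      (1 / (lam + 1)) *\<^sub>R x_avg f \<eta> x m
      + (lam / (lam + 1)) *\<^sub>R fst (eg_iterate f \<eta> (x, 0) m))"

text \<open>Every integrator step evaluates the gradient twice, at \<open>x_half\<close> and at \<open>x_next\<close>.\<close>

definition gradient_evaluations :: "(nat \<Rightarrow> nat) \<Rightarrow> nat \<Rightarrow> nat" where
  "gradient_evaluations N K = 2 * (\<Sum>k = 1..K. N k)"

primrec step_count :: "nat \<Rightarrow> nat" where
  "step_count 0 = 4"
| "step_count (Suc k) = nat \<lceil>sqrt (3 / (1 + sqrt 3)) * real (step_count k) + 1 / 2\<rceil>"

end

theory Submission
  imports Defs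
begin

text \<open>Put \<open>\<phi> = (f - f xstar) / L\<close>, and let \<open>T\<close> be the running time of one inner run. The
  integrator discretizes the Hamiltonian flow \<open>x' = y\<close>, \<open>y' = - \<nabla>\<phi>(x)\<close> started at rest. Along
  the flow the energy \<open>\<phi>(x) + |y|\<^sup>2 / 2\<close> is constant, and convexity gives
  \<open>\<nabla>\<phi>(x) \<bullet> (x - xstar) \<ge> \<phi>(x)\<close>, so that
  \<open>(|x - xstar|\<^sup>2 / 2)'' = |y|\<^sup>2 - \<nabla>\<phi>(x) \<bullet> (x - xstar) \<le> 2 \<phi>(x(0)) - 3 \<phi>(x)\<close>.
  Integrating twice produces exactly the weights \<open>T - t\<close> of the average: the averaged point has
  value at most \<open>2/3 \<phi>(x(0))\<close> plus \<open>(|x(0) - xstar|\<^sup>2 - |x(T) - xstar|\<^sup>2) / (3 T\<^sup>2)\<close>.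

  The extragradient step with \<open>\<eta> = 1 / sqrt L\<close> reproduces this without any loss, \<open>T\<^sup>2\<close> being
  replaced by \<open>m (m + 1)\<close>: its energy does not increase (\<open>energy_step\<close>), and each use of
  convexity and smoothness in the continuous argument becomes an instance of the interpolation
  inequality of smooth convex functions (\<open>virial_step\<close>, \<open>dist_step\<close>,
  \<open>weighted_value_bound\<close>).

  Because of the distance term this is not a contraction of values alone, and the distance of the
  next starting point must be controlled as well. The bound for the average contains the negative
  term \<open>- |x(T) - xstar|\<^sup>2\<close>, which pays for the distance of the endpoint. Mixing average and
  endpoint in the proportion \<open>1 : lam\<close> therefore makes
  \<open>\<phi>(x) + |x - xstar|\<^sup>2 / (3 lam T\<^sup>2)\<close> a Lyapunov function (\<open>lyapunov_step\<close>): in one outer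
  iteration the coefficient of \<open>\<phi>\<close> shrinks at least by the factor \<open>1 / q\<close>, \<open>q = 3 / (1 + sqrt 3)\<close>, and the
  coefficient of the squared distance is unchanged. If \<open>T\<^sup>2\<close> grows by the factor \<open>q\<close> in each outer
  iteration, the whole function shrinks by \<open>1 / q\<close> (\<open>dHFA_eg_linear_rate\<close>). Its
  initial value is at most \<open>|x0 - xstar|\<^sup>2\<close>, and \<open>K\<close> is chosen such that \<open>q ^ K\<close> is at least
  \<open>L / \<epsilon> |x0 - xstar|\<^sup>2\<close>.

  The step counts grow like \<open>sqrt q ^ k\<close>, so their sum is at most a constant multiple of the last
  term, which is of the order \<open>sqrt (q ^ K)\<close>. Rounding \<open>K\<close> up costs at most one factor \<open>sqrt q\<close>.\<close>

section \<open>Smooth convex functions\<close>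

lemma convex_on_if_tangents:
  fixes h :: "'a::real_inner \<Rightarrow> real"
  assumes tangent: "\<And>a b. h b + g b \<bullet> (a - b) \<le> h a"
  shows "convex_on UNIV h"
proof (rule convex_onI)
  fix t :: real and x y :: 'a
  assume t: "0 < t" "t < 1"
  define z where "z = (1 - t) *\<^sub>R x + t *\<^sub>R y"
  have "(1 - t) * (h z + g z \<bullet> (x - z)) + t * (h z + g z \<bullet> (y - z)) \<le> (1 - t) * h x + t * h y"
    using t by (intro add_mono mult_left_mono tangent) auto
  moreover have "(1 - t) * (g z \<bullet> (x - z)) + t * (g z \<bullet> (y - z)) = g z \<bullet> (z - z)"
    by (simp add: z_def inner_simps algebra_simps)
  ultimately show "h ((1 - t) *\<^sub>R x + t *\<^sub>R y) \<le> (1 - t) * h x + t * h y"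
    by (simp add: z_def algebra_simps)
qed auto

lemma convex_on_dist_square:
  fixes c :: "'a::real_inner"
  shows "convex_on UNIV (\<lambda>x. (norm (x - c))\<^sup>2)"
proof (rule convex_on_if_tangents)
  fix a b :: 'a
  have "0 \<le> (a - b) \<bullet> (a - b)"
    by simp
  then show "(norm (b - c))\<^sup>2 + (2 *\<^sub>R (b - c)) \<bullet> (a - b) \<le> (norm (a - c))\<^sup>2"
    by (simp add: power2_norm_eq_inner inner_simps inner_commute)
qed

text \<open>Restricting to the line through \<open>b\<close> and \<open>a\<close> reduces this to the one-dimensional tangent
  inequality.\<close>

lemma convex_gradient_inequality:
  fixes f :: "'a::euclidean_space \<Rightarrow> real"
  assumes "f differentiable (at b)" and "convex_on UNIV f"
  shows "f b + gradient f b \<bullet> (a - b) \<le> f a"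
proof -
  define line where "line = (\<lambda>t::real. b + t *\<^sub>R (a - b))"
  have convex: "convex_on UNIV (f \<circ> line)"
  proof (rule convex_onI)
    fix t x y :: real
    assume "0 < t" "t < 1"
    moreover have "line ((1 - t) *\<^sub>R x + t *\<^sub>R y) = (1 - t) *\<^sub>R line x + t *\<^sub>R line y"
      by (simp add: line_def algebra_simps)
    ultimately show "(f \<circ> line) ((1 - t) *\<^sub>R x + t *\<^sub>R y) \<le> (1 - t) * (f \<circ> line) x + t * (f \<circ> line) y"
      using convex_onD[OF assms(2), of t "line x" "line y"] by simp
  qed auto
  have deriv: "(f \<circ> line has_real_derivative gradient f b \<bullet> (a - b)) (at 0)"
  proof -
    have "(f has_derivative (\<lambda>v. v \<bullet> gradient f b)) (at (line 0))"
      using GDERIV_gradient[OF assms(1)] by (simp add: gderiv_def line_def)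
    moreover have "(line has_derivative (\<lambda>t. t *\<^sub>R (a - b))) (at 0)"
      unfolding line_def by (auto intro!: derivative_eq_intros)
    ultimately show ?thesis
      using diff_chain_at[of line "\<lambda>t. t *\<^sub>R (a - b)" 0 f "\<lambda>v. v \<bullet> gradient f b"]
      by (simp add: has_field_derivative_def o_def inner_commute mult_commute_abs)
  qed
  have "(f \<circ> line) 1 - (f \<circ> line) 0 \<ge> gradient f b \<bullet> (a - b) * (1 - 0)"
    by (rule convex_on_imp_above_tangent[OF convex _ _ _ deriv]) auto
  then show ?thesis
    by (simp add: line_def)
qed

text \<open>A gradient step \<open>z\<close> from \<open>a\<close> on the function \<open>f - gradient f b \<bullet> _\<close>, which is minimal at
  \<open>b\<close>, decreases it by the squared-norm term and cannot get below the value at \<open>b\<close>.\<close>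

lemma smooth_convex_interpolation:
  fixes f :: "'a::euclidean_space \<Rightarrow> real"
  assumes "\<forall>x. f differentiable (at x)" and "convex_on UNIV f" and "L > 0" and "L_smooth L f"
  shows "f b + gradient f b \<bullet> (a - b) + (norm (gradient f a - gradient f b))\<^sup>2 / (2 * L) \<le> f a"
proof -
  define \<delta> where "\<delta> = gradient f a - gradient f b"
  define z where "z = a - (1 / L) *\<^sub>R \<delta>"
  have "f z \<le> f a + gradient f a \<bullet> (z - a) + L / 2 * (norm (z - a))\<^sup>2"
    using assms(4) by (simp add: L_smooth_def)
  moreover have "f b + gradient f b \<bullet> (z - b) \<le> f z"
    using assms(1,2) by (intro convex_gradient_inequality) auto
  moreover have "L / 2 * (norm (z - a))\<^sup>2 = (norm \<delta>)\<^sup>2 / (2 * L)"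
    using assms(3) by (simp add: z_def power_divide power2_eq_square field_simps)
  moreover have "gradient f b \<bullet> (z - b) = gradient f b \<bullet> (a - b) - gradient f b \<bullet> \<delta> / L"
    by (simp add: z_def inner_simps)
  moreover have "gradient f a \<bullet> (z - a) = - (gradient f a \<bullet> \<delta> / L)"
    by (simp add: z_def)
  moreover have "gradient f a \<bullet> \<delta> / L = gradient f b \<bullet> \<delta> / L + 2 * ((norm \<delta>)\<^sup>2 / (2 * L))"
    using assms(3) by (simp add: \<delta>_def power2_norm_eq_inner inner_simps inner_commute field_simps)
  ultimately show ?thesis
    unfolding \<delta>_def by linarith
qed

lemma gradient_at_minimizer:
  fixes f :: "'a::euclidean_space \<Rightarrow> real"
  assumes "L > 0" and "L_smooth L f" and "\<And>y. f x \<le> f y"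
  shows "gradient f x = 0"
proof -
  define g where "g = gradient f x"
  have "f x \<le> f (x - (1 / L) *\<^sub>R g)"
    by (rule assms(3))
  also have "\<dots> \<le> f x + g \<bullet> ((x - (1 / L) *\<^sub>R g) - x) + L / 2 * (norm ((x - (1 / L) *\<^sub>R g) - x))\<^sup>2"
    using assms(2) unfolding L_smooth_def g_def by blast
  also have "\<dots> = f x - (norm g)\<^sup>2 / (2 * L)"
    using assms(1) by (simp add: power_divide power2_norm_eq_inner[symmetric] power2_eq_square field_simps)
  finally have "(norm g)\<^sup>2 / (2 * L) \<le> 0"
    by simp
  then show ?thesis
    using assms(1) by (simp add: g_def divide_le_0_iff)
qed

text \<open>The interpolation inequality is all that the analysis of the integrator uses. Absorbing
  \<open>\<eta>\<^sup>2 = 1 / L\<close> into the function and its gradient, and subtracting the minimum, makes the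
  smoothness constant and the step size equal to one.\<close>

locale normalized_smooth_convex =
  fixes \<phi> :: "'a::real_inner \<Rightarrow> real" and \<gamma> :: "'a \<Rightarrow> 'a" and xs :: 'a
  assumes interpolation: "\<phi> b + \<gamma> b \<bullet> (a - b) + (norm (\<gamma> a - \<gamma> b))\<^sup>2 / 2 \<le> \<phi> a"
    and value_xs: "\<phi> xs = 0" and gradient_xs: "\<gamma> xs = 0"
begin

lemma tangent: "\<phi> b + \<gamma> b \<bullet> (a - b) \<le> \<phi> a"
  using interpolation[of b a] zero_le_power2[of "norm (\<gamma> a - \<gamma> b)"] by linarith

lemma value_nonneg: "0 \<le> \<phi> a"
  using tangent[of xs a] by (simp add: value_xs gradient_xs)

text \<open>The interpolation inequality towards the minimizer, with Young's inequality for the product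
  of gradient and displacement.\<close>

lemma value_le_dist_square: "\<phi> a \<le> (norm (a - xs))\<^sup>2 / 2"
proof -
  have "\<phi> a + \<gamma> a \<bullet> (xs - a) + (norm (\<gamma> a))\<^sup>2 / 2 \<le> 0"
    using interpolation[of a xs] by (simp add: value_xs gradient_xs)
  moreover have "0 \<le> (norm (\<gamma> a - (a - xs)))\<^sup>2 / 2"
    by simp
  ultimately show ?thesis
    by (simp add: power2_norm_eq_inner inner_simps inner_commute field_simps)
qed

lemma convex_value: "convex_on UNIV \<phi>"
  by (rule convex_on_if_tangents[OF tangent])

end

section \<open>The extragradient integrator\<close>

text \<open>\<open>U\<close> is the velocity multiplied by the step size.\<close>

locale extragradient_trajectory = normalized_smooth_convex \<phi> \<gamma> xs
  for \<phi> :: "'a::real_inner \<Rightarrow> real" and \<gamma> :: "'a \<Rightarrow> 'a" and xs :: 'a +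
  fixes X U :: "nat \<Rightarrow> 'a"
  assumes U_0: "U 0 = 0"
    and X_Suc: "X (Suc n) = X n + U n - \<gamma> (X n + U n)"
    and U_Suc: "U (Suc n) = U n - \<gamma> (X (Suc n))"
begin

text \<open>The position update is a full gradient step from the half point, so it does not increase
  the value; this lets the later lemmas pass from values at half points to values of iterates.\<close>

lemma half_step_descent:
  "\<phi> (X (Suc n)) + (norm (\<gamma> (X n + U n)))\<^sup>2 / 2 + (norm (\<gamma> (X (Suc n))))\<^sup>2 / 2 \<le> \<phi> (X n + U n)"
proof -
  define g where "g = \<gamma> (X n + U n)"
  define g' where "g' = \<gamma> (X (Suc n))"
  have "X n + U n - X (Suc n) = g"
    by (simp add: X_Suc g_def)
  then have "\<phi> (X (Suc n)) + g' \<bullet> g + (norm (g - g'))\<^sup>2 / 2 \<le> \<phi> (X n + U n)"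
    using interpolation[of "X (Suc n)" "X n + U n"] by (simp add: g_def g'_def)
  then show ?thesis
    unfolding g_def[symmetric] g'_def[symmetric]
    by (simp add: power2_norm_eq_inner inner_simps inner_commute field_simps)
qed

text \<open>With \<open>g\<close> and \<open>g'\<close> the gradients at the half point and at the new point, the tangent at the
  new point bounds the change of energy by \<open>|g'|\<^sup>2 / 2 - g' \<bullet> g\<close>. Adding the two interpolation
  inequalities between these points gives \<open>|g'|\<^sup>2 \<le> g' \<bullet> g\<close>: a gradient step of length one
  cannot overshoot.\<close>

lemma energy_step:
  "\<phi> (X (Suc n)) + (norm (U (Suc n)))\<^sup>2 / 2 \<le> \<phi> (X n) + (norm (U n))\<^sup>2 / 2"
proof -
  define g where "g = \<gamma> (X n + U n)"
  define g' where "g' = \<gamma> (X (Suc n))"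
  have diffs: "X n - X (Suc n) = g - U n" "X (Suc n) - (X n + U n) = - g"
    by (simp_all add: X_Suc g_def)
  have "\<phi> (X (Suc n)) + g' \<bullet> (g - U n) \<le> \<phi> (X n)"
    using tangent[of "X (Suc n)" "X n"] unfolding diffs g'_def .
  moreover have "\<phi> (X (Suc n)) + g \<bullet> g / 2 + g' \<bullet> g' / 2 \<le> \<phi> (X n + U n)"
    using half_step_descent[of n] by (simp add: g_def g'_def power2_norm_eq_inner)
  moreover have "\<phi> (X n + U n) - g \<bullet> g + (norm (g' - g))\<^sup>2 / 2 \<le> \<phi> (X (Suc n))"
    using interpolation[of "X n + U n" "X (Suc n)"]
    unfolding diffs g_def[symmetric] g'_def[symmetric] by simp
  moreover have "0 \<le> g' \<bullet> g'"
    by simp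
  moreover have "(norm (g' - g))\<^sup>2 = g' \<bullet> g' - 2 * (g' \<bullet> g) + g \<bullet> g"
    by (simp add: power2_norm_eq_inner inner_simps inner_commute)
  moreover have "(norm (U n - g'))\<^sup>2 = (norm (U n))\<^sup>2 - 2 * (g' \<bullet> U n) + g' \<bullet> g'"
    by (simp add: power2_norm_eq_inner inner_simps inner_commute)
  ultimately show ?thesis
    unfolding U_Suc g'_def[symmetric] inner_diff_right by linarith
qed

lemma energy_bound: "\<phi> (X n) + (norm (U n))\<^sup>2 / 2 \<le> \<phi> (X 0)"
proof (induction n)
  case 0
  then show ?case by (simp add: U_0)
next
  case (Suc n)
  then show ?case using energy_step[of n] by linarith
qed

lemma value_bound: "\<phi> (X n) \<le> \<phi> (X 0)"
  using energy_bound[of n] zero_le_power2[of "norm (U n)"] by linarith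

text \<open>The discrete form of \<open>((x - xstar) \<bullet> y)' \<le> 2 \<phi>(x(0)) - 3 \<phi>(x)\<close>. The kinetic term is eliminated
  by the energy bound, which contributes \<open>- 2 \<phi>\<close>; convexity towards the minimizer contributes
  the third \<open>- \<phi>\<close>. The half step in the position update is what splits the three copies of \<open>\<phi>\<close>
  between the old and the new iterate.\<close>

lemma virial_step:
  "(X (Suc n) - xs) \<bullet> U (Suc n)
    \<le> (X n - xs) \<bullet> U n + 2 * \<phi> (X 0) - \<phi> (X n) - 2 * \<phi> (X (Suc n))"
proof -
  define g where "g = \<gamma> (X n + U n)"
  define g' where "g' = \<gamma> (X (Suc n))"
  have "\<phi> (X (Suc n)) \<le> g' \<bullet> (X (Suc n) - xs)"
    using tangent[of "X (Suc n)" xs] by (simp add: g'_def value_xs inner_diff_right)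
  moreover have "\<phi> (X n + U n) - g \<bullet> U n \<le> \<phi> (X n)"
    using tangent[of "X n + U n" "X n"] by (simp add: g_def)
  moreover have "\<phi> (X (Suc n)) \<le> \<phi> (X n + U n)"
    using half_step_descent[of n] zero_le_power2[of "norm g"] zero_le_power2[of "norm g'"]
    unfolding g_def g'_def by linarith
  moreover have "\<phi> (X n) + U n \<bullet> U n / 2 \<le> \<phi> (X 0)"
    using energy_bound[of n] by (simp add: power2_norm_eq_inner)
  moreover have "X (Suc n) = X n + U n - g"
    by (simp add: X_Suc g_def)
  then have "(X (Suc n) - xs) \<bullet> U (Suc n)
      = (X n - xs) \<bullet> U n + U n \<bullet> U n - g \<bullet> U n - g' \<bullet> (X (Suc n) - xs)"
    unfolding U_Suc g'_def[symmetric]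
    by (simp add: inner_simps inner_commute)
  ultimately show ?thesis
    by linarith
qed

text \<open>The discrete form of \<open>(|x - xstar|\<^sup>2 / 2)' = (x - xstar) \<bullet> y\<close>. The second-order term
  \<open>|U n|\<^sup>2 / 2\<close> that a discrete step adds is again bounded by the energy, and the gradient step from
  the half point pays for \<open>- \<phi> (X (Suc n))\<close>.\<close>

lemma dist_step:
  "(norm (X (Suc n) - xs))\<^sup>2 / 2
    \<le> (norm (X n - xs))\<^sup>2 / 2 + (X n - xs) \<bullet> U n + \<phi> (X 0) - \<phi> (X n) - \<phi> (X (Suc n))"
proof -
  define g where "g = \<gamma> (X n + U n)"
  have X': "X (Suc n) = X n + U n - g"
    by (simp add: X_Suc g_def)
  have "\<phi> (X n + U n) + g \<bullet> g / 2 \<le> g \<bullet> (X n + U n - xs)"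
    using interpolation[of "X n + U n" xs]
    by (simp add: g_def value_xs gradient_xs inner_simps power2_norm_eq_inner)
  moreover have "\<phi> (X (Suc n)) \<le> \<phi> (X n + U n)"
    using half_step_descent[of n] zero_le_power2[of "norm g"]
      zero_le_power2[of "norm (\<gamma> (X (Suc n)))"]
    unfolding g_def by linarith
  moreover have "\<phi> (X n) + U n \<bullet> U n / 2 \<le> \<phi> (X 0)"
    using energy_bound[of n] by (simp add: power2_norm_eq_inner)
  moreover have "(norm (X (Suc n) - xs))\<^sup>2 / 2 = (norm (X n - xs))\<^sup>2 / 2 + (X n - xs) \<bullet> U n
      + U n \<bullet> U n / 2 - g \<bullet> (X n + U n - xs) + g \<bullet> g / 2"
    unfolding X' by (simp add: power2_norm_eq_inner inner_simps inner_commute field_simps)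
  ultimately show ?thesis
    by linarith
qed

text \<open>Summing the first \<open>n\<close> instances of \<open>virial_step\<close> counts \<open>X 0\<close> once and \<open>X n\<close> twice, all
  other iterates three times; the terms added on the left cancel the former and complete the latter.\<close>

lemma virial_bound:
  "(X n - xs) \<bullet> U n + \<phi> (X 0) - \<phi> (X n) \<le> 2 * real n * \<phi> (X 0) - 3 * (\<Sum>i=1..n. \<phi> (X i))"
proof (induction n)
  case 0
  then show ?case by (simp add: U_0)
next
  case (Suc n)
  then show ?case using virial_step[of n] by (simp add: algebra_simps)
qed

lemma dist_increment:
  "(norm (X (Suc n) - xs))\<^sup>2 / 2
    \<le> (norm (X n - xs))\<^sup>2 / 2 + 2 * real n * \<phi> (X 0) - 3 * (\<Sum>i=1..n. \<phi> (X i)) - \<phi> (X (Suc n))"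
  using dist_step[of n] virial_bound[of n] by linarith

lemma dist_bound: "(norm (X n - xs))\<^sup>2 \<le> (norm (X 0 - xs))\<^sup>2 + 2 * real n * (real n - 1) * \<phi> (X 0)"
proof (induction n)
  case 0
  then show ?case by simp
next
  case (Suc n)
  moreover have "0 \<le> (\<Sum>i=1..n. \<phi> (X i))"
    by (intro sum_nonneg value_nonneg)
  ultimately show ?case
    using dist_increment[of n] value_nonneg[of "X (Suc n)"] by (simp add: algebra_simps)
qed

text \<open>The second summation. Discretely it yields the weights \<open>3 (n - i + 1) - 2\<close> instead of
  \<open>3 (n - i + 1)\<close>, hence the additional sum on the right.\<close>

lemma weighted_value_bound_sharp:
  "(norm (X n - xs))\<^sup>2 / 2 + 3 * (\<Sum>i=1..n. (real n - real i + 1) * \<phi> (X i))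
    \<le> (norm (X 0 - xs))\<^sup>2 / 2 + real n * (real n - 1) * \<phi> (X 0) + 2 * (\<Sum>i=1..n. \<phi> (X i))"
proof (induction n)
  case 0
  then show ?case by simp
next
  case (Suc n)
  have "(\<Sum>i=1..Suc n. (real (Suc n) - real i + 1) * \<phi> (X i))
      = (\<Sum>i=1..n. (real n - real i + 1) * \<phi> (X i)) + (\<Sum>i=1..Suc n. \<phi> (X i))"
    by (simp add: sum.distrib[symmetric] algebra_simps)
  moreover have "(\<Sum>i=1..Suc n. \<phi> (X i)) = (\<Sum>i=1..n. \<phi> (X i)) + \<phi> (X (Suc n))"
    by simp
  moreover have "real (Suc n) * (real (Suc n) - 1) * \<phi> (X 0)
      = real n * (real n - 1) * \<phi> (X 0) + 2 * real n * \<phi> (X 0)"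
    by (simp add: algebra_simps)
  ultimately show ?case
    using Suc dist_increment[of n] by linarith
qed

text \<open>The bound \<open>\<phi> (X i) \<le> \<phi> (X 0)\<close> for the additional sum turns \<open>n (n - 1)\<close> into
  \<open>n (n + 1)\<close>, which is twice the total weight, so that the weighted average inherits the factor
  \<open>2/3\<close> of the continuous flow.\<close>

lemma weighted_value_bound:
  "(norm (X n - xs))\<^sup>2 / 2 + 3 * (\<Sum>i=1..n. (real n - real i + 1) * \<phi> (X i))
    \<le> (norm (X 0 - xs))\<^sup>2 / 2 + real n * (real n + 1) * \<phi> (X 0)"
proof -
  have "(\<Sum>i=1..n. \<phi> (X i)) \<le> real (card {1..n}) * \<phi> (X 0)"
    by (intro sum_bounded_above value_bound)
  then show ?thesis
    using weighted_value_bound_sharp[of n] by (simp add: algebra_simps)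
qed

end

section \<open>The weighted average\<close>

definition avg_weight :: "nat \<Rightarrow> nat \<Rightarrow> real" where
  "avg_weight m n = 2 * (real m - real n + 1) / (real m * (real m + 1))"

lemma avg_weight_nonneg: "n \<le> m \<Longrightarrow> 0 \<le> avg_weight m n"
  by (simp add: avg_weight_def)

lemma weighted_sum_const: "(\<Sum>n=1..m. real m - real n + 1) = real m * (real m + 1) / 2"
proof (induction m)
  case (Suc m)
  have "(\<Sum>n=1..Suc m. real (Suc m) - real n + 1)
      = (\<Sum>n=1..m. (real m - real n + 1) + 1) + 1"
    by (simp add: algebra_simps)
  then show ?case
    using Suc unfolding sum.distrib by (simp add: field_simps)
qed simp

text \<open>Increasing \<open>m\<close> by one adds one to every weight, which adds an unweighted sum.\<close>

lemma weighted_sum_falling: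
  "(\<Sum>n=1..m. (real m - real n + 1) * (real n * (real n - 1)))
    = (real m + 2) * (real m + 1) * real m * (real m - 1) / 12"
proof (induction m)
  case (Suc m)
  have sum: "(\<Sum>n=1..m. real n * (real n - 1)) = (real m + 1) * real m * (real m - 1) / 3" for m
    by (induction m) (simp_all add: field_simps)
  have "(\<Sum>n=1..Suc m. (real (Suc m) - real n + 1) * (real n * (real n - 1)))
      = (\<Sum>n=1..m. (real m - real n + 1) * (real n * (real n - 1)))
        + (\<Sum>n=1..Suc m. real n * (real n - 1))"
    by (simp add: sum.distrib[symmetric] algebra_simps)
  then show ?case
    unfolding Suc sum by (simp add: field_simps)
qed simp

lemma avg_weight_sum: "m > 0 \<Longrightarrow> (\<Sum>n=1..m. avg_weight m n) = 1"
  unfolding avg_weight_def sum_divide_distrib[symmetric] sum_distrib_left[symmetric]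
    weighted_sum_const
  by simp

lemma convex_on_weighted_average:
  fixes h :: "'a::real_vector \<Rightarrow> real"
  assumes "convex_on UNIV h" and "m > 0"
  shows "h (\<Sum>n=1..m. avg_weight m n *\<^sub>R X n) \<le> (\<Sum>n=1..m. avg_weight m n * h (X n))"
  using assms(2) avg_weight_sum[of m]
  by (intro convex_on_sum[OF _ _ assms(1)]) (auto simp: avg_weight_nonneg)

lemma sum_avg_weight:
  "(\<Sum>n=1..m. avg_weight m n * c n)
    = 2 * (\<Sum>n=1..m. (real m - real n + 1) * c n) / (real m * (real m + 1))"
  unfolding sum_distrib_left sum_divide_distrib avg_weight_def by (intro sum.cong) auto

context extragradient_trajectory
begin

lemma average_value_bound:
  assumes "m > 0"
  shows "\<phi> (\<Sum>n=1..m. avg_weight m n *\<^sub>R X n)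
    \<le> 2 / 3 * \<phi> (X 0) + ((norm (X 0 - xs))\<^sup>2 - (norm (X m - xs))\<^sup>2) / (3 * (real m * (real m + 1)))"
proof -
  define M where "M = real m * (real m + 1)"
  have "M > 0"
    using assms by (simp add: M_def)
  have "\<phi> (\<Sum>n=1..m. avg_weight m n *\<^sub>R X n) \<le> (\<Sum>n=1..m. avg_weight m n * \<phi> (X n))"
    by (rule convex_on_weighted_average[OF convex_value assms])
  also have "\<dots> = 2 * (\<Sum>n=1..m. (real m - real n + 1) * \<phi> (X n)) / M"
    unfolding sum_avg_weight M_def ..
  also have "\<dots> \<le> 2 * ((((norm (X 0 - xs))\<^sup>2 - (norm (X m - xs))\<^sup>2) / 2 + M * \<phi> (X 0)) / 3) / M"
    using weighted_value_bound[of m] \<open>M > 0\<close>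
    by (intro divide_right_mono mult_left_mono) (auto simp: M_def field_simps)
  also have "\<dots> = 2 / 3 * \<phi> (X 0) + ((norm (X 0 - xs))\<^sup>2 - (norm (X m - xs))\<^sup>2) / (3 * M)"
    using \<open>M > 0\<close> by (simp add: field_simps)
  finally show ?thesis
    by (simp add: M_def)
qed

lemma average_dist_bound:
  assumes "m > 0"
  shows "(norm ((\<Sum>n=1..m. avg_weight m n *\<^sub>R X n) - xs))\<^sup>2
    \<le> (norm (X 0 - xs))\<^sup>2 + real m * (real m + 1) / 3 * \<phi> (X 0)"
proof -
  define M where "M = real m * (real m + 1)"
  have "M > 0"
    using assms by (simp add: M_def)
  have "(norm ((\<Sum>n=1..m. avg_weight m n *\<^sub>R X n) - xs))\<^sup>2
      \<le> (\<Sum>n=1..m. avg_weight m n * (norm (X n - xs))\<^sup>2)"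
    by (rule convex_on_weighted_average[OF convex_on_dist_square assms])
  also have "\<dots> \<le> (\<Sum>n=1..m. avg_weight m n
      * ((norm (X 0 - xs))\<^sup>2 + 2 * real n * (real n - 1) * \<phi> (X 0)))"
    by (intro sum_mono mult_left_mono dist_bound avg_weight_nonneg) auto
  also have "\<dots> = (\<Sum>n=1..m. avg_weight m n) * (norm (X 0 - xs))\<^sup>2
      + (\<Sum>n=1..m. avg_weight m n * (real n * (real n - 1))) * (2 * \<phi> (X 0))"
    unfolding sum_distrib_right sum.distrib[symmetric]
    by (intro sum.cong) (auto simp: algebra_simps)
  also have "\<dots> = (norm (X 0 - xs))\<^sup>2 + (M - 2) / 3 * \<phi> (X 0)"
  proof -
    \<comment> \<open>\<open>(m + 2) (m - 1) = M - 2\<close>\<close>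
    have "(\<Sum>n=1..m. avg_weight m n * (real n * (real n - 1))) = 2 * (M * (M - 2) / 12) / M"
      unfolding sum_avg_weight weighted_sum_falling by (simp add: M_def algebra_simps)
    then show ?thesis
      unfolding avg_weight_sum[OF assms] using \<open>M > 0\<close> by simp
  qed
  also have "\<dots> \<le> (norm (X 0 - xs))\<^sup>2 + M / 3 * \<phi> (X 0)"
    by (intro add_left_mono mult_right_mono value_nonneg) auto
  finally show ?thesis
    by (simp add: M_def)
qed

text \<open>Up to the common factor \<open>1 / (lam + 1)\<close>, the average contributes
  \<open>- |X m - xs|\<^sup>2 / (3 M)\<close> to the value, and the endpoint contributes
  \<open>lam |X m - xs|\<^sup>2\<close> to the squared distance. The coefficient
  \<open>1 / (3 lam M)\<close> is the one for which these cancel, and for it the coefficients of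
  \<open>|X 0 - xs|\<^sup>2\<close> add up to \<open>1 / (3 lam M)\<close> again.\<close>

lemma lyapunov_step:
  assumes "m > 0" and "lam > 0"
  defines "M \<equiv> real m * (real m + 1)"
    and "x \<equiv> (1 / (lam + 1)) *\<^sub>R (\<Sum>n=1..m. avg_weight m n *\<^sub>R X n) + (lam / (lam + 1)) *\<^sub>R X m"
  shows "\<phi> x + (norm (x - xs))\<^sup>2 / (3 * lam * M)
    \<le> (2 / 3 + lam + 1 / (9 * lam)) / (lam + 1) * \<phi> (X 0) + (norm (X 0 - xs))\<^sup>2 / (3 * lam * M)"
proof -
  define a where "a = (\<Sum>n=1..m. avg_weight m n *\<^sub>R X n)"
  define d0 dm where "d0 = (norm (X 0 - xs))\<^sup>2" and "dm = (norm (X m - xs))\<^sup>2"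
  define \<theta> where "\<theta> = 1 / (lam + 1)"
  have \<theta>: "0 \<le> \<theta>" "\<theta> \<le> 1" "lam / (lam + 1) = 1 - \<theta>" "1 - \<theta> = lam * \<theta>"
    using assms(2) by (auto simp: \<theta>_def field_simps)
  have M: "M > 0"
    using assms(1) by (simp add: M_def)
  have x: "x = (1 - \<theta>) *\<^sub>R X m + \<theta> *\<^sub>R a"
    unfolding x_def a_def[symmetric] \<theta>(3) by (simp add: \<theta>_def)
  have "\<phi> x \<le> (1 - \<theta>) * \<phi> (X m) + \<theta> * \<phi> a"
    unfolding x using \<theta> by (intro convex_onD[OF convex_value]) auto
  also have "\<dots> \<le> (1 - \<theta>) * \<phi> (X 0) + \<theta> * (2 / 3 * \<phi> (X 0) + (d0 - dm) / (3 * M))"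
    using average_value_bound[OF assms(1)] value_bound[of m] \<theta>
    by (intro add_mono mult_left_mono) (auto simp: a_def d0_def dm_def M_def)
  finally have value_x: "\<phi> x \<le> \<theta> * (lam * \<phi> (X 0) + 2 / 3 * \<phi> (X 0) + (d0 - dm) / (3 * M))"
    unfolding \<theta>(4) distrib_left by (simp only: ac_simps)
  have "(norm (x - xs))\<^sup>2 \<le> (1 - \<theta>) * dm + \<theta> * (norm (a - xs))\<^sup>2"
    unfolding x dm_def using \<theta> by (intro convex_onD[OF convex_on_dist_square]) auto
  also have "\<dots> \<le> (1 - \<theta>) * dm + \<theta> * (d0 + M / 3 * \<phi> (X 0))"
    using average_dist_bound[OF assms(1)] \<theta>
    by (intro add_left_mono mult_left_mono) (auto simp: a_def d0_def M_def)
  also have "\<dots> = \<theta> * (lam * dm + d0 + M / 3 * \<phi> (X 0))"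
    unfolding \<theta>(4) by (simp add: algebra_simps)
  finally have "(norm (x - xs))\<^sup>2 / (3 * lam * M) \<le> \<theta> * (lam * dm + d0 + M / 3 * \<phi> (X 0)) / (3 * lam * M)"
    using assms(2) M by (intro divide_right_mono) auto
  also have "\<dots> = \<theta> * (dm / (3 * M) + d0 / (3 * lam * M) + 1 / (9 * lam) * \<phi> (X 0))"
    using assms(2) M by (simp add: add_divide_distrib distrib_left)
  finally have "\<phi> x + (norm (x - xs))\<^sup>2 / (3 * lam * M)
      \<le> \<theta> * (lam * \<phi> (X 0) + 2 / 3 * \<phi> (X 0) + (d0 - dm) / (3 * M))
        + \<theta> * (dm / (3 * M) + d0 / (3 * lam * M) + 1 / (9 * lam) * \<phi> (X 0))"
    using value_x by linarith
  also have "\<dots> = \<theta> * (2 / 3 + lam + 1 / (9 * lam)) * \<phi> (X 0) + \<theta> * ((lam + 1) * (d0 / (3 * lam * M)))"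
  proof -
    have "(d0 - dm) / (3 * M) + (dm / (3 * M) + d0 / (3 * lam * M)) = (lam + 1) * (d0 / (3 * lam * M))"
      using assms(2) by (simp add: diff_divide_distrib add_divide_distrib distrib_right)
    then show ?thesis
      unfolding distrib_left[symmetric] mult.assoc by (simp add: distrib_right)
  qed
  also have "\<dots> = (2 / 3 + lam + 1 / (9 * lam)) / (lam + 1) * \<phi> (X 0) + d0 / (3 * lam * M)"
    using assms(2) by (simp add: \<theta>_def)
  finally show ?thesis
    by (simp add: d0_def)
qed

end

section \<open>Linear convergence of the outer iteration\<close>

lemma eg_iterate_Suc:
  "eg_iterate f \<eta> z (Suc n) = eg_step f \<eta> (eg_iterate f \<eta> z n)"
  by (simp add: eg_iterate_def)

lemma x_avg_eq: "x_avg f \<eta> x m = (\<Sum>n=1..m. avg_weight m n *\<^sub>R fst (eg_iterate f \<eta> (x, 0) n))"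
  by (simp add: x_avg_def scaleR_sum_right avg_weight_def)

lemma eg_extragradient_trajectory:
  assumes "normalized_smooth_convex \<phi> (\<lambda>x. \<eta>\<^sup>2 *\<^sub>R gradient f x) xs"
  shows "extragradient_trajectory \<phi> (\<lambda>x. \<eta>\<^sup>2 *\<^sub>R gradient f x) xs
    (\<lambda>n. fst (eg_iterate f \<eta> (x, 0) n)) (\<lambda>n. \<eta> *\<^sub>R snd (eg_iterate f \<eta> (x, 0) n))"
proof -
  interpret normalized_smooth_convex \<phi> "\<lambda>x. \<eta>\<^sup>2 *\<^sub>R gradient f x" xs
    by fact
  show ?thesis
    by unfold_locales
      (simp_all add: eg_iterate_Suc eg_step_def case_prod_beta Let_def
        scaleR_diff_right power2_eq_square, simp add: eg_iterate_def)
qed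

lemma normalized_smooth_convex_objective:
  fixes f :: "'a::euclidean_space \<Rightarrow> real"
  assumes "\<forall>x. f differentiable (at x)" and "convex_on UNIV f" and "L > 0" and "L_smooth L f"
    and "\<And>y. f xs \<le> f y"
  shows "normalized_smooth_convex (\<lambda>x. (f x - f xs) / L) (\<lambda>x. (1 / sqrt L)\<^sup>2 *\<^sub>R gradient f x) xs"
proof
  fix a b
  define \<delta> where "\<delta> = gradient f a - gradient f b"
  have eq: "(1 / sqrt L)\<^sup>2 *\<^sub>R gradient f a - (1 / sqrt L)\<^sup>2 *\<^sub>R gradient f b = (1 / L) *\<^sub>R \<delta>"
    using assms(3) by (simp add: \<delta>_def power_divide scaleR_diff_right)
  have "(f b + gradient f b \<bullet> (a - b) + (norm \<delta>)\<^sup>2 / (2 * L) - f xs) / L \<le> (f a - f xs) / L"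
    using smooth_convex_interpolation[OF assms(1-4), of b a] assms(3)
    by (intro divide_right_mono) (auto simp: \<delta>_def)
  then show "(f b - f xs) / L + (1 / sqrt L)\<^sup>2 *\<^sub>R gradient f b \<bullet> (a - b)
      + (norm ((1 / sqrt L)\<^sup>2 *\<^sub>R gradient f a - (1 / sqrt L)\<^sup>2 *\<^sub>R gradient f b))\<^sup>2 / 2
      \<le> (f a - f xs) / L"
    unfolding eq using assms(3)
    by (simp add: power_divide diff_divide_distrib add_divide_distrib power2_eq_square)
next
  show "(1 / sqrt L)\<^sup>2 *\<^sub>R gradient f xs = 0"
    using gradient_at_minimizer[OF assms(3-5)] by simp
qed simp

text \<open>Run \<open>k + 1\<close> of the inner loop is analysed with the coefficient \<open>1 / (3 lam M (Suc k))\<close> of the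
  squared distance at both of its ends. The growth of \<open>M\<close> bounds this by \<open>1 / q\<close> times the
  coefficient of the preceding run, and \<open>1 / q\<close> is also the factor by which the value term shrinks.
  For the first run, \<open>N 0\<close> takes the place of the preceding step count.\<close>

lemma dHFA_eg_linear_rate:
  fixes N :: "nat \<Rightarrow> nat" and x0 :: "'a::real_inner"
  assumes "normalized_smooth_convex \<phi> (\<lambda>x. \<eta>\<^sup>2 *\<^sub>R gradient f x) xs"
    and "lam > 0" and rate: "(2 / 3 + lam + 1 / (9 * lam)) / (lam + 1) \<le> 1 / q" and "q > 0"
    and "\<And>k. N k > 0"
    and growth: "\<And>k. q * (real (N k) * (real (N k) + 1)) \<le> real (N (Suc k)) * (real (N (Suc k)) + 1)"
  defines "M \<equiv> \<lambda>k. real (N k) * (real (N k) + 1)"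
    and "x \<equiv> dHFA_eg f lam \<eta> N x0"
  shows "\<phi> (x k) + (norm (x k - xs))\<^sup>2 / (3 * lam * M k)
    \<le> (1 / q) ^ k * (\<phi> x0 + (norm (x0 - xs))\<^sup>2 / (3 * lam * M 0))"
proof (induction k)
  case 0
  then show ?case by (simp add: x_def)
next
  case (Suc k)
  interpret normalized_smooth_convex \<phi> "\<lambda>x. \<eta>\<^sup>2 *\<^sub>R gradient f x" xs
    by fact
  interpret trajectory: extragradient_trajectory \<phi> "\<lambda>x. \<eta>\<^sup>2 *\<^sub>R gradient f x" xs
    "\<lambda>n. fst (eg_iterate f \<eta> (x k, 0) n)" "\<lambda>n. \<eta> *\<^sub>R snd (eg_iterate f \<eta> (x k, 0) n)"
    by (rule eg_extragradient_trajectory) fact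
  have M: "M j > 0" for j
    using assms(5)[of j] by (simp add: M_def)
  have start: "fst (eg_iterate f \<eta> (x k, 0) 0) = x k"
    by (simp add: eg_iterate_def)
  have x_Suc: "x (Suc k) = (1 / (lam + 1)) *\<^sub>R
        (\<Sum>n=1..N (Suc k). avg_weight (N (Suc k)) n *\<^sub>R fst (eg_iterate f \<eta> (x k, 0) n))
      + (lam / (lam + 1)) *\<^sub>R fst (eg_iterate f \<eta> (x k, 0) (N (Suc k)))"
    unfolding x_def by (simp only: dHFA_eg.simps Let_def x_avg_eq)
  have "\<phi> (x (Suc k)) + (norm (x (Suc k) - xs))\<^sup>2 / (3 * lam * M (Suc k))
      \<le> (2 / 3 + lam + 1 / (9 * lam)) / (lam + 1) * \<phi> (x k)
        + (norm (x k - xs))\<^sup>2 / (3 * lam * M (Suc k))"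
    using trajectory.lyapunov_step[OF assms(5)[of "Suc k"] assms(2)]
    unfolding x_Suc[symmetric] start M_def .
  also have "\<dots> \<le> 1 / q * \<phi> (x k) + (norm (x k - xs))\<^sup>2 / (3 * lam * (q * M k))"
  proof (rule add_mono)
    show "(2 / 3 + lam + 1 / (9 * lam)) / (lam + 1) * \<phi> (x k) \<le> 1 / q * \<phi> (x k)"
      by (intro mult_right_mono rate value_nonneg)
    have "3 * lam * (q * M k) \<le> 3 * lam * M (Suc k)"
      using growth[of k] assms(2) by (simp add: M_def)
    then show "(norm (x k - xs))\<^sup>2 / (3 * lam * M (Suc k)) \<le> (norm (x k - xs))\<^sup>2 / (3 * lam * (q * M k))"
      using assms(2,4) M by (intro divide_left_mono) auto
  qed
  also have "\<dots> = 1 / q * (\<phi> (x k) + (norm (x k - xs))\<^sup>2 / (3 * lam * M k))"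
    using assms(2,4) M[of k] by (simp add: field_simps)
  also have "\<dots> \<le> 1 / q * ((1 / q) ^ k * (\<phi> x0 + (norm (x0 - xs))\<^sup>2 / (3 * lam * M 0)))"
    using assms(4) by (intro mult_left_mono Suc) auto
  finally show ?case
    by simp
qed

section \<open>Step counts and iteration number\<close>

definition growth_ratio :: real where
  "growth_ratio = 3 / (1 + sqrt 3)"

lemma sqrt3_bounds: "17320500 / 10000000 < sqrt 3" "sqrt 3 < 17320509 / 10000000"
  by (rule real_less_rsqrt real_less_lsqrt; simp add: power2_eq_square)+

lemma growth_ratio_eq: "growth_ratio = 3 * (sqrt 3 - 1) / 2"
proof -
  have "1 + sqrt 3 > 0"
    using sqrt3_bounds by linarith
  then show ?thesis
    by (simp add: growth_ratio_def field_simps)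
qed

lemma growth_ratio_bounds: "growth_ratio > 1" "growth_ratio < 109808 / 100000"
  using sqrt3_bounds by (simp_all add: growth_ratio_eq)

lemma sqrt_growth_ratio_bounds: "104789 / 100000 < sqrt growth_ratio" "sqrt growth_ratio > 1"
proof -
  show "104789 / 100000 < sqrt growth_ratio"
    by (rule real_less_rsqrt) (use sqrt3_bounds in \<open>simp add: growth_ratio_eq power2_eq_square\<close>)
  then show "sqrt growth_ratio > 1"
    by linarith
qed

text \<open>With \<open>1 / (6 lam)\<close> in place of \<open>1 / (9 lam)\<close> there is equality: \<open>(sqrt 3 + 1) / 2\<close> is the
  positive root of \<open>2 lam\<^sup>2 - 2 lam - 1\<close> and minimizes the resulting expression in \<open>lam\<close>.\<close>

lemma contraction_factor:
  fixes lam :: real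
  defines "lam \<equiv> (sqrt 3 + 1) / 2"
  shows "(2 / 3 + lam + 1 / (9 * lam)) / (lam + 1) \<le> 1 / growth_ratio"
proof -
  have lam: "lam > 0" "lam * lam = lam + 1 / 2"
    using sqrt3_bounds by (simp_all add: lam_def field_simps)
  have "1 / (9 * lam) \<le> 1 / (6 * lam)"
    using lam(1) by (simp add: field_simps)
  also have "\<dots> = (lam - 1) / 3"
  proof -
    have "(lam - 1) / 3 * (6 * lam) = 1"
      using lam(2) by (simp add: left_diff_distrib)
    then show ?thesis
      using lam(1) by (intro sym[OF iffD2[OF nonzero_eq_divide_eq]]) auto
  qed
  finally have "2 / 3 + lam + 1 / (9 * lam) \<le> 2 / 3 + lam + (lam - 1) / 3"
    by simp
  also have "\<dots> = 2 / 3 * lam * (lam + 1)"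
    unfolding distrib_left mult.assoc lam(2) by (simp add: field_simps)
  also have "2 / 3 * lam = 1 / growth_ratio"
    by (simp add: lam_def growth_ratio_def)
  finally show ?thesis
    using lam(1) by (simp add: divide_le_eq)
qed

lemma step_count_Suc_bounds:
  "sqrt growth_ratio * real (step_count k) + 1 / 2 \<le> real (step_count (Suc k))"
  "real (step_count (Suc k)) < sqrt growth_ratio * real (step_count k) + 3 / 2"
proof -
  define r where "r = sqrt growth_ratio * real (step_count k) + 1 / 2"
  have "r \<ge> 0"
    using growth_ratio_bounds(1) by (simp add: r_def)
  then have "real (step_count (Suc k)) = of_int \<lceil>r\<rceil>"
    by (simp add: r_def growth_ratio_def)
  then have "r \<le> real (step_count (Suc k))" "real (step_count (Suc k)) < r + 1"
    by linarith+
  then show "sqrt growth_ratio * real (step_count k) + 1 / 2 \<le> real (step_count (Suc k))"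
    "real (step_count (Suc k)) < sqrt growth_ratio * real (step_count k) + 3 / 2"
    by (simp_all add: r_def)
qed

lemma step_count_pos: "step_count k > 0"
proof (cases k)
  case (Suc j)
  have "0 \<le> sqrt growth_ratio * real (step_count j)"
    using growth_ratio_bounds(1) by simp
  then have "0 < real (step_count (Suc j))"
    using step_count_Suc_bounds(1)[of j] by linarith
  then show ?thesis
    using Suc by simp
qed simp

text \<open>The offset \<open>1/2\<close> in the recursion is there for this inequality: scaling \<open>n\<close> by \<open>s\<close> scales
  \<open>n\<^sup>2\<close> correctly, but for \<open>n (n + 1)\<close> the linear term \<open>s\<^sup>2 n\<close> must be covered too, which the
  cross term \<open>2 s n\<close> does since \<open>s \<le> 2\<close>.\<close>

lemma step_count_growth:
  "growth_ratio * (real (step_count k) * (real (step_count k) + 1))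
    \<le> real (step_count (Suc k)) * (real (step_count (Suc k)) + 1)"
proof -
  define s where "s = sqrt growth_ratio"
  define n where "n = real (step_count k)"
  have s: "s * s = growth_ratio" "1 \<le> s" "s \<le> 2"
    using growth_ratio_bounds by (auto simp: s_def intro!: real_le_lsqrt)
  have "s * s * n \<le> 2 * s * n"
    using s by (intro mult_right_mono) (auto simp: n_def)
  then have "growth_ratio * (n * (n + 1)) \<le> (s * n + 1 / 2) * (s * n + 1 / 2 + 1)"
    unfolding s(1)[symmetric] by (simp add: algebra_simps)
  also have "\<dots> \<le> real (step_count (Suc k)) * (real (step_count (Suc k)) + 1)"
  proof -
    have "0 \<le> s * n"
      using s(2) by (simp add: n_def)
    moreover have "s * n + 1 / 2 \<le> real (step_count (Suc k))"
      unfolding s_def n_def by (rule step_count_Suc_bounds)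
    ultimately show ?thesis
      by (intro mult_mono add_right_mono) linarith+
  qed
  finally show ?thesis
    by (simp add: n_def)
qed

text \<open>Rounding adds less than \<open>3/2\<close> per step to a multiplication by \<open>s\<close>. The fixed point of
  \<open>n \<mapsto> s n + 3/2\<close> is \<open>- 3 / (2 (s - 1))\<close>, and the distance to it grows by the factor \<open>s\<close>.\<close>

lemma step_count_upper:
  defines "s \<equiv> sqrt growth_ratio"
  shows "real (step_count k) + 3 / (2 * (s - 1)) \<le> (4 + 3 / (2 * (s - 1))) * s ^ k"
proof (induction k)
  case 0
  then show ?case by simp
next
  case (Suc k)
  have s: "s > 1"
    using sqrt_growth_ratio_bounds(2) by (simp add: s_def)
  have "real (step_count (Suc k)) + 3 / (2 * (s - 1)) \<le> s * real (step_count k) + 3 / 2 + 3 / (2 * (s - 1))"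
    using step_count_Suc_bounds(2)[of k] by (simp add: s_def)
  also have "\<dots> = s * (real (step_count k) + 3 / (2 * (s - 1)))"
    using s by (simp add: field_simps)
  also have "\<dots> \<le> s * ((4 + 3 / (2 * (s - 1))) * s ^ k)"
    using s by (intro mult_left_mono Suc) auto
  finally show ?case
    by (simp add: algebra_simps)
qed

lemma step_count_sum_upper:
  defines "s \<equiv> sqrt growth_ratio"
  shows "(\<Sum>k=1..K. real (step_count k)) \<le> (4 + 3 / (2 * (s - 1))) * s / (s - 1) * s ^ K"
proof -
  have s: "s > 1"
    using sqrt_growth_ratio_bounds(2) by (simp add: s_def)
  have "(\<Sum>k=1..K. real (step_count k)) \<le> (\<Sum>k=1..K. (4 + 3 / (2 * (s - 1))) * s ^ k)"
  proof (rule sum_mono)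
    fix k
    have "0 \<le> 3 / (2 * (s - 1))"
      using s by simp
    then show "real (step_count k) \<le> (4 + 3 / (2 * (s - 1))) * s ^ k"
      using step_count_upper[of k] unfolding s_def by linarith
  qed
  also have "\<dots> = (4 + 3 / (2 * (s - 1))) * (\<Sum>k=1..K. s ^ k)"
    by (simp add: sum_distrib_left)
  also have "\<dots> \<le> (4 + 3 / (2 * (s - 1))) * (s / (s - 1) * s ^ K)"
  proof (rule mult_left_mono)
    have "(\<Sum>k=1..K. s ^ k) = s / (s - 1) * (s ^ K - 1)"
      using s by (induction K) (simp_all add: field_simps)
    also have "\<dots> \<le> s / (s - 1) * s ^ K"
      using s by (intro mult_left_mono) auto
    finally show "(\<Sum>k=1..K. s ^ k) \<le> s / (s - 1) * s ^ K" .
  qed (use s in auto)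
  finally show ?thesis
    by simp
qed

text \<open>The left-hand side is about \<open>1619.73\<close>, which is why \<open>sqrt 3\<close> is enclosed to six digits above.\<close>

lemma evaluation_constant:
  defines "s \<equiv> sqrt growth_ratio"
  shows "2 * ((4 + 3 / (2 * (s - 1))) * s / (s - 1) * s) \<le> 1620"
proof -
  have s: "104789 / 100000 < s" "s * s = growth_ratio"
    using sqrt_growth_ratio_bounds growth_ratio_bounds by (auto simp: s_def)
  then have "s * s < 109808 / 100000"
    using growth_ratio_bounds by simp
  \<comment> \<open>\<open>1 / (s - 1)\<close> is decreasing in \<open>s\<close>, so its bound needs the lower bound on \<open>s\<close> and the factor
    \<open>s * s\<close> the upper one.\<close>
  have inv: "1 / (s - 1) \<le> 100000 / 4789"
    using s(1) by (simp add: field_simps)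
  have "2 * ((4 + 3 / (2 * (s - 1))) * s / (s - 1) * s) = (8 + 3 * (1 / (s - 1))) * (1 / (s - 1)) * (s * s)"
    using s(1) by (simp add: divide_simps)
  also have "\<dots> \<le> (8 + 3 * (100000 / 4789)) * (100000 / 4789) * (109808 / 100000)"
    using inv s(1) \<open>s * s < _\<close> by (intro mult_mono add_mono mult_left_mono) auto
  also have "\<dots> \<le> 1620"
    by simp
  finally show ?thesis .
qed

text \<open>Taking logarithms, \<open>M = s ^ t\<close> for the number \<open>t\<close> that is rounded up to \<open>K\<close>, hence
  \<open>s ^ K\<close> lies between \<open>M\<close> and \<open>s M\<close>. The assumption \<open>K > 0\<close> excludes \<open>M \<le> 1\<close>, and in
  particular \<open>M = 0\<close>, where \<open>ln M\<close> has the default value \<open>0\<close>.\<close>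

lemma outer_iterations_bounds:
  fixes M :: real
  defines "s \<equiv> sqrt growth_ratio"
  assumes K: "int K = \<lceil>2 * inverse (ln growth_ratio) * ln M\<rceil>" and "K > 0" and "M \<ge> 0"
  shows "M\<^sup>2 \<le> growth_ratio ^ K" and "s ^ K \<le> s * M"
proof -
  have q: "growth_ratio > 1"
    by (rule growth_ratio_bounds)
  then have ln_q: "ln growth_ratio > 0"
    by (rule ln_gt_zero)
  have ln_s: "ln s = ln growth_ratio / 2"
    using q by (simp add: s_def ln_sqrt)
  define t where "t = 2 * inverse (ln growth_ratio) * ln M"
  have t: "ln M = ln growth_ratio / 2 * t"
    using ln_q by (simp add: t_def)
  have tK: "t \<le> real K" "real K < t + 1"
    using K unfolding t_def[symmetric] by linarith+
  have "t > 0"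
  proof (rule ccontr)
    assume "\<not> t > 0"
    then have "real K < 1"
      using tK by simp
    then show False
      using \<open>K > 0\<close> by simp
  qed
  then have "ln M > 0"
    unfolding t using ln_q by simp
  then have M: "M > 0"
    using \<open>M \<ge> 0\<close> by (cases "M = 0") auto
  have s: "s > 1"
    using q by (simp add: s_def)
  have "ln (M\<^sup>2) = ln growth_ratio * t"
    using M by (simp add: ln_realpow t)
  also have "\<dots> \<le> ln (growth_ratio ^ K)"
    using tK ln_q q by (simp add: ln_realpow mult.commute)
  finally show "M\<^sup>2 \<le> growth_ratio ^ K"
    using M q by (subst (asm) ln_le_cancel_iff) auto
  have "ln (s ^ K) = real K * (ln growth_ratio / 2)"
    using s by (simp add: ln_realpow ln_s)
  also have "\<dots> \<le> (t + 1) * (ln growth_ratio / 2)"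
    using tK ln_q by (intro mult_right_mono) auto
  also have "\<dots> = ln (s * M)"
    using s M by (simp add: ln_mult ln_s t algebra_simps)
  finally show "s ^ K \<le> s * M"
    using M s by (subst (asm) ln_le_cancel_iff) auto
qed

section \<open>Accuracy and complexity\<close>

theorem corollary5:
  fixes f :: "real ^ 'n \<Rightarrow> real"
    and L \<epsilon> :: real
    and x0 xstar :: "real ^ 'n"
    and K :: nat
  assumes "\<forall>x. f differentiable (at x)"
    and "convex_on UNIV f"
    and "L > 0"
    and "L_smooth L f"
    and "unique_minimizer f xstar"
    and "\<epsilon> > 0"
    and "int K = \<lceil>2 * inverse (ln (3 / (1 + sqrt 3))) * ln (sqrt (L / \<epsilon>) * norm (x0 - xstar))\<rceil>"
    and "K > 0"
  shows "f (dHFA_eg f ((sqrt 3 + 1) / 2) (1 / sqrt L) step_count x0 K) - f xstar \<le> \<epsilon> \<and>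
    real (gradient_evaluations step_count K) \<le> 1620 * sqrt (L / \<epsilon>) * norm (x0 - xstar)"
proof
  define lam :: real where "lam = (sqrt 3 + 1) / 2"
  define \<phi> where "\<phi> = (\<lambda>x. (f x - f xstar) / L)"
  define D where "D = norm (x0 - xstar)"
  define M where "M = sqrt (L / \<epsilon>) * D"
  define x where "x = dHFA_eg f lam (1 / sqrt L) step_count x0"
  have q: "growth_ratio > 0"
    using growth_ratio_bounds(1) by linarith
  have lam: "lam \<ge> 1"
    using sqrt3_bounds by (simp add: lam_def)
  have M: "M \<ge> 0" "M\<^sup>2 = L / \<epsilon> * D\<^sup>2"
    using assms(3,6) by (auto simp: M_def D_def power_mult_distrib)
  have K: "int K = \<lceil>2 * inverse (ln growth_ratio) * ln M\<rceil>"
    using assms(7) by (simp add: M_def D_def growth_ratio_def mult.assoc)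
  note iterations = outer_iterations_bounds[OF K assms(8) M(1)]
  have "f xstar \<le> f y" for y
    using assms(5) by (auto simp: unique_minimizer_def)
  then have normalized: "normalized_smooth_convex \<phi> (\<lambda>x. (1 / sqrt L)\<^sup>2 *\<^sub>R gradient f x) xstar"
    unfolding \<phi>_def by (intro normalized_smooth_convex_objective assms(1-4))
  define P where "P = (\<lambda>k. 3 * lam * (real (step_count k) * (real (step_count k) + 1)))"
  have P: "P 0 \<ge> 2" "P K \<ge> 0"
    using lam by (auto simp: P_def)
  have "(2 / 3 + lam + 1 / (9 * lam)) / (lam + 1) \<le> 1 / growth_ratio"
    unfolding lam_def by (rule contraction_factor)
  then have "\<phi> (x K) + (norm (x K - xstar))\<^sup>2 / P K
      \<le> (1 / growth_ratio) ^ K * (\<phi> x0 + D\<^sup>2 / P 0)"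
    unfolding x_def D_def P_def using lam q
    by (intro dHFA_eg_linear_rate[OF normalized] step_count_pos step_count_growth) auto
  also have "\<dots> \<le> (1 / growth_ratio) ^ K * (D\<^sup>2 / 2 + D\<^sup>2 / 2)"
  proof (intro mult_left_mono add_mono)
    show "\<phi> x0 \<le> D\<^sup>2 / 2"
      unfolding D_def by (rule normalized_smooth_convex.value_le_dist_square[OF normalized])
    show "D\<^sup>2 / P 0 \<le> D\<^sup>2 / 2"
      using P by (intro divide_left_mono) auto
  qed (use q in auto)
  finally have "\<phi> (x K) \<le> (1 / growth_ratio) ^ K * D\<^sup>2"
    using divide_nonneg_nonneg[OF zero_le_power2 P(2), of "norm (x K - xstar)"] by simp
  then have "f (x K) - f xstar \<le> L * D\<^sup>2 / growth_ratio ^ K"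
    using assms(3) unfolding \<phi>_def power_one_over by (simp add: pos_divide_le_eq mult.commute)
  also have "\<dots> = \<epsilon> * M\<^sup>2 / growth_ratio ^ K"
    using assms(6) M(2) by simp
  also have "\<dots> \<le> \<epsilon>"
    using iterations(1) q assms(6) by (simp add: divide_le_eq zero_less_power)
  finally show "f (dHFA_eg f ((sqrt 3 + 1) / 2) (1 / sqrt L) step_count x0 K) - f xstar \<le> \<epsilon>"
    by (simp add: x_def lam_def)

  define s where "s = sqrt growth_ratio"
  define C where "C = (4 + 3 / (2 * (s - 1))) * s / (s - 1)"
  have "s > 1"
    using sqrt_growth_ratio_bounds(2) by (simp add: s_def)
  then have "C \<ge> 0"
    by (simp add: C_def)
  have "real (gradient_evaluations step_count K) = 2 * (\<Sum>k=1..K. real (step_count k))"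
    by (simp add: gradient_evaluations_def)
  also have "\<dots> \<le> 2 * (C * s ^ K)"
    using step_count_sum_upper[of K] by (simp add: C_def s_def)
  also have "\<dots> \<le> 2 * (C * (s * M))"
    using iterations(2) \<open>C \<ge> 0\<close> by (intro mult_left_mono) (auto simp: s_def)
  also have "\<dots> = 2 * (C * s) * M"
    by simp
  also have "\<dots> \<le> 1620 * M"
    using evaluation_constant M(1) unfolding C_def s_def by (intro mult_right_mono) auto
  finally show "real (gradient_evaluations step_count K) \<le> 1620 * sqrt (L / \<epsilon>) * norm (x0 - xstar)"
    by (simp add: M_def D_def mult.assoc)
qed

end
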